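(* Let $f_1(x)=1$ and $f_j(x)=\sqrt2\cos(2\pi(j-1)x)$ for $j\ge2$, $x\in\mathcal X=[0,1]$. Consider the regression model $y(x)=\theta_1f_{i_1}(x)+\dots+\theta_mf_{i_m}(x)+\varepsilon(x)$, $x\in[0,1]$, with regression functions $f_{i_1},\dots,f_{i_m}$ $(1\le i_1<\dots<i_m)$ and covariance kernel $K(u,v)=\rho(u-v)$, where the correlation function $\rho$ is periodic with period $1$, i.e. $\rho(t)=\rho(t+1)$. Then the uniform design (the uniform distribution on $[0,1]$) is universally optimal.
   Context: A correlation function $\rho$ is an even continuous function with $\rho(0)=1$ such that $K(u,v)=\rho(u-v)$ is positive definite: $\iint K(u,v)\,\nu(du)\,\nu(dv)\ge0$ for every signed measure $\nu$ on $[0,1]$. A design is a (Borel) probability measure $\xi$ on $\mathcal X=[0,1]$. With $f=(f_{i_1},\dots,f_{i_m})^T$ set $$M(\xi)=\int f(u)f^T(u)\,\xi(du),\quad B(\xi,\xi)=\iint K(u,v)f(u)f^T(v)\,\xi(du)\,\xi(dv),$$ $$D(\xi)=M^{-1}(\xi)B(\xi,\xi)M^{-1}(\xi),$$ and let $\Xi$ be the set of designs for which $B(\xi,\xi)$ and $M^{-1}(\xi)$ are well defined. A design $\xi^*\in\Xi$ is universally optimal if $D(\xi^* )\le D(\xi)$ in the Loewner ordering for every $\xi\in\Xi$. *)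

theory Defs
  imports "HOL-Probability.Probability"
begin

abbreviation unit_borel :: "real measure" where
  "unit_borel \<equiv> restrict_space borel {0..1}"

subsection \<open>Signed measures\<close>

text \<open>Finite signed Borel measures on $[0,1]$, as set functions; only the values on Borel
  subsets of $[0,1]$ matter.\<close>

definition signed_measure :: "(real set \<Rightarrow> real) \<Rightarrow> bool" where
  "signed_measure \<nu> \<longleftrightarrow>
     \<nu> {} = 0 \<and>
     (\<forall>A. range A \<subseteq> sets unit_borel \<longrightarrow> disjoint_family A \<longrightarrow>
        (\<lambda>n::nat. \<nu> (A n)) sums \<nu> (\<Union>n. A n))"

text \<open>The positive part of the Jordan decomposition, $\nu^+(A) = \sup \{\nu(B) : B \subseteq A\}$.
  The truncation of negative values by \<^const>\<open>ennreal\<close> is harmless, as $B = \emptyset$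
  contributes $0$ to the supremum.\<close>

definition positive_variation :: "(real set \<Rightarrow> real) \<Rightarrow> real measure" where
  "positive_variation \<nu> = measure_of (space unit_borel) (sets unit_borel)
     (\<lambda>A. SUP B\<in>{B \<in> sets unit_borel. B \<subseteq> A}. ennreal (\<nu> B))"

definition negative_variation :: "(real set \<Rightarrow> real) \<Rightarrow> real measure" where
  "negative_variation \<nu> = positive_variation (\<lambda>A. - \<nu> A)"

definition signed_integral :: "(real set \<Rightarrow> real) \<Rightarrow> (real \<Rightarrow> real) \<Rightarrow> real" where
  "signed_integral \<nu> g =
     (\<integral>u. g u \<partial>positive_variation \<nu>) - (\<integral>u. g u \<partial>negative_variation \<nu>)"

subsection \<open>Kernels and correlation functions\<close>

definition positive_definite_kernel :: "(real \<Rightarrow> real \<Rightarrow> real) \<Rightarrow> bool" where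
  "positive_definite_kernel K \<longleftrightarrow>
     (\<forall>\<nu>. signed_measure \<nu> \<longrightarrow>
        0 \<le> signed_integral \<nu> (\<lambda>v. signed_integral \<nu> (\<lambda>u. K u v)))"

definition correlation_function :: "(real \<Rightarrow> real) \<Rightarrow> bool" where
  "correlation_function \<rho> \<longleftrightarrow>
     (\<forall>t. \<rho> (- t) = \<rho> t) \<and> continuous_on UNIV \<rho> \<and> \<rho> 0 = 1 \<and>
     positive_definite_kernel (\<lambda>u v. \<rho> (u - v))"

subsection \<open>Designs and universal optimality\<close>

definition design :: "real measure \<Rightarrow> bool" where
  "design \<xi> \<longleftrightarrow> prob_space \<xi> \<and> sets \<xi> = sets unit_borel"

definition M_matrix :: "(real \<Rightarrow> real ^ 'm) \<Rightarrow> real measure \<Rightarrow> real ^ 'm ^ 'm" where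
  "M_matrix f \<xi> = (\<chi> j k. \<integral>u. f u $ j * f u $ k \<partial>\<xi>)"

definition B_matrix ::
  "(real \<Rightarrow> real \<Rightarrow> real) \<Rightarrow> (real \<Rightarrow> real ^ 'm) \<Rightarrow> real measure \<Rightarrow> real ^ 'm ^ 'm" where
  "B_matrix K f \<xi> = (\<chi> j k. \<integral>(u, v). K u v * f u $ j * f v $ k \<partial>(\<xi> \<Otimes>\<^sub>M \<xi>))"

definition D_matrix ::
  "(real \<Rightarrow> real \<Rightarrow> real) \<Rightarrow> (real \<Rightarrow> real ^ 'm) \<Rightarrow> real measure \<Rightarrow> real ^ 'm ^ 'm" where
  "D_matrix K f \<xi> = matrix_inv (M_matrix f \<xi>) ** B_matrix K f \<xi> ** matrix_inv (M_matrix f \<xi>)"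

text \<open>The class $\Xi$. Well-definedness of the matrices means that all entries are integrals of
  integrable functions, and that $M(\xi)$ is invertible.\<close>

definition admissible_designs ::
  "(real \<Rightarrow> real \<Rightarrow> real) \<Rightarrow> (real \<Rightarrow> real ^ 'm) \<Rightarrow> real measure set" where
  "admissible_designs K f = {\<xi>. design \<xi> \<and>
     (\<forall>j k. integrable (\<xi> \<Otimes>\<^sub>M \<xi>) (\<lambda>(u, v). K u v * f u $ j * f v $ k)) \<and>
     (\<forall>j k. integrable \<xi> (\<lambda>u. f u $ j * f u $ k)) \<and>
     invertible (M_matrix f \<xi>)}"

definition positive_semidefinite :: "real ^ 'm ^ 'm \<Rightarrow> bool" where
  "positive_semidefinite A \<longleftrightarrow> transpose A = A \<and> (\<forall>x. 0 \<le> x \<bullet> (A *v x))"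

definition loewner_le :: "real ^ 'm ^ 'm \<Rightarrow> real ^ 'm ^ 'm \<Rightarrow> bool" where
  "loewner_le A B \<longleftrightarrow> positive_semidefinite (B - A)"

definition universally_optimal ::
  "(real \<Rightarrow> real \<Rightarrow> real) \<Rightarrow> (real \<Rightarrow> real ^ 'm) \<Rightarrow> real measure \<Rightarrow> bool" where
  "universally_optimal K f \<xi>' \<longleftrightarrow>
     \<xi>' \<in> admissible_designs K f \<and>
     (\<forall>\<xi> \<in> admissible_designs K f. loewner_le (D_matrix K f \<xi>') (D_matrix K f \<xi>))"

subsection \<open>The trigonometric regression functions and the uniform design\<close>

text \<open>Indices start at $1$; the value at index $0$ is irrelevant.\<close>

definition cosine_fn :: "nat \<Rightarrow> real \<Rightarrow> real" where
  "cosine_fn j x = (if j = 1 then 1 else sqrt 2 * cos (2 * pi * (real j - 1) * x))"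

definition uniform_design :: "real measure" where
  "uniform_design = uniform_measure (restrict_space lborel {0..1}) {0..1}"

end

theory Submission
  imports Defs
begin

text \<open>Periodicity makes each $f_k$ an eigenfunction, with some eigenvalue $\lambda_k$, of the integral
  operator with kernel $\rho(u - v)$ for the uniform measure, and the $f_k$ are orthonormal; hence
  $D$ of the uniform design is $\Lambda = \mathrm{diag}(\lambda_k)$. For another design $\xi$, write
  a vector as $x = M(\xi) y$, so that $x^T D(\xi) x = y^T B(\xi, \xi) y$ is the energy of the signed measure
  $(y^T f) \, d\xi$. Subtracting from it $(x^T f(u)) \, du$, which has the same moments against
  the $f_k$, gives a signed measure of energy $x^T D(\xi) x - x^T \Lambda x$, and this is nonnegative
  because the kernel is positive definite.\<close>

subsection \<open>Signed measures given by densities\<close>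

text \<open>The Jordan decomposition of w dM has parts max(0, w) dM and max(0, -w) dM, because the
  supremum defining \<open>positive_variation\<close> is attained on the part of A where w is
  nonnegative. This turns the set-function definition of \<open>signed_integral\<close> into
  ordinary integrals.\<close>

lemma signed_integral_density:
  fixes w \<phi> :: "real \<Rightarrow> real"
  assumes fin_M: "finite_measure M"
    and sets_M: "sets M = sets unit_borel"
    and w: "integrable M w"
    and \<phi>: "integrable M (\<lambda>x. \<phi> x * w x)" "\<phi> \<in> borel_measurable M"
  defines "\<nu> \<equiv> \<lambda>A. \<integral>x. indicator A x * w x \<partial>M"
  shows "signed_measure \<nu>" and "signed_integral \<nu> \<phi> = (\<integral>x. \<phi> x * w x \<partial>M)"
proof -
  have [measurable]: "w \<in> borel_measurable M" "\<phi> \<in> borel_measurable M"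
    using w \<phi> by auto
  have space_M: "space M = space unit_borel"
    using sets_M by (rule sets_eq_imp_space_eq)
  have ind: "integrable M (\<lambda>x. indicator A x * v x)"
    if "A \<in> sets M" "integrable M v" for A and v :: "real \<Rightarrow> real"
    using integrable_mult_indicator[OF that] by simp
  have pos_int: "integrable M (\<lambda>x. max 0 (v x))" if "integrable M v" for v :: "real \<Rightarrow> real"
    using that by (intro integrable_max) auto
  have em: "emeasure (density M (\<lambda>x. max 0 (v x))) A = ennreal (\<integral>x. indicator A x * max 0 (v x) \<partial>M)"
    if "A \<in> sets M" "integrable M v" for A and v :: "real \<Rightarrow> real"
  proof -
    have "emeasure (density M (\<lambda>x. max 0 (v x))) A = (\<integral>\<^sup>+x. ennreal (indicator A x * max 0 (v x)) \<partial>M)"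
      using that by (subst emeasure_density) (auto intro!: nn_integral_cong simp: indicator_def)
    also have "\<dots> = ennreal (\<integral>x. indicator A x * max 0 (v x) \<partial>M)"
      by (intro nn_integral_eq_integral ind pos_int that) auto
    finally show ?thesis .
  qed
  have me: "measure (density M (\<lambda>x. max 0 (v x))) A = (\<integral>x. indicator A x * max 0 (v x) \<partial>M)"
    if "A \<in> sets M" "integrable M v" for A and v :: "real \<Rightarrow> real"
    using em[OF that] by (simp add: measure_def integral_nonneg_AE)
  \<comment> \<open>Countable additivity of \<nu> is inherited from these two finite
    measures.\<close>
  have \<nu>_eq: "\<nu> A = measure (density M (\<lambda>x. max 0 (w x))) A - measure (density M (\<lambda>x. max 0 (- w x))) A"
    if "A \<in> sets M" for A
  proof -
    have "\<nu> A = (\<integral>x. indicator A x * max 0 (w x) - indicator A x * max 0 (- w x) \<partial>M)"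
      unfolding \<nu>_def by (intro Bochner_Integration.integral_cong) (auto simp: indicator_def)
    also have "\<dots> = (\<integral>x. indicator A x * max 0 (w x) \<partial>M) - (\<integral>x. indicator A x * max 0 (- w x) \<partial>M)"
      using w that by (intro Bochner_Integration.integral_diff ind pos_int) auto
    also have "\<dots> = measure (density M (\<lambda>x. max 0 (w x))) A - measure (density M (\<lambda>x. max 0 (- w x))) A"
      using w that by (subst (1 2) me) auto
    finally show ?thesis .
  qed
  have fin: "finite_measure (density M (\<lambda>x. max 0 (v x)))" if "integrable M v" for v :: "real \<Rightarrow> real"
    using em[OF sets.top that] by (intro finite_measureI) simp
  show "signed_measure \<nu>"
    unfolding signed_measure_def
  proof (intro conjI allI impI)
    show "\<nu> {} = 0" by (simp add: \<nu>_def)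
  next
    fix A :: "nat \<Rightarrow> real set"
    assume A: "range A \<subseteq> sets unit_borel" "disjoint_family A"
    have AM: "A n \<in> sets M" "(\<Union>n. A n) \<in> sets M" for n
      using A by (auto simp: sets_M intro!: sets.countable_UN)
    show "(\<lambda>n. \<nu> (A n)) sums \<nu> (\<Union>n. A n)"
      unfolding \<nu>_eq[OF AM(1)] \<nu>_eq[OF AM(2)] using A w
      by (intro sums_diff finite_measure.finite_measure_UNION fin) (auto simp: sets_M)
  qed
  \<comment> \<open>Stated for a general v, since it is applied to w and, for the negative
    variation, to -w.\<close>
  have pv: "positive_variation (\<lambda>A. \<integral>x. indicator A x * v x \<partial>M) = density M (\<lambda>x. max 0 (v x))"
    if v: "integrable M v" for v :: "real \<Rightarrow> real"
  proof -
    have [measurable]: "v \<in> borel_measurable M" using v by auto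
    have "positive_variation (\<lambda>A. \<integral>x. indicator A x * v x \<partial>M) =
      measure_of (space unit_borel) (sets unit_borel) (emeasure (density M (\<lambda>x. max 0 (v x))))"
      unfolding positive_variation_def
    proof (rule measure_of_eq[OF sets.space_closed])
      fix A assume "A \<in> sigma_sets (space unit_borel) (sets unit_borel)"
      then have A: "A \<in> sets M"
        by (metis sets.sigma_sets_eq sets_M)
      show "(SUP B\<in>{B \<in> sets unit_borel. B \<subseteq> A}. ennreal (\<integral>x. indicator B x * v x \<partial>M)) =
        emeasure (density M (\<lambda>x. max 0 (v x))) A"
        unfolding em[OF A v]
      proof (rule antisym)
        show "(SUP B\<in>{B \<in> sets unit_borel. B \<subseteq> A}. ennreal (\<integral>x. indicator B x * v x \<partial>M)) \<le>
          ennreal (\<integral>x. indicator A x * max 0 (v x) \<partial>M)"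
          by (intro SUP_least ennreal_leI integral_mono ind v pos_int A)
             (auto simp: sets_M indicator_def)
        \<comment> \<open>A \<inter> P is where the supremum is attained: it keeps exactly the part
          of A that contributes nonnegatively.\<close>
        define P where "P = {x \<in> space M. 0 \<le> v x}"
        have "P \<in> sets M" unfolding P_def by measurable
        then have "A \<inter> P \<in> {B \<in> sets unit_borel. B \<subseteq> A}"
          using A sets_M by auto
        note SUP_upper[OF this, of "\<lambda>B. ennreal (\<integral>x. indicator B x * v x \<partial>M)"]
        moreover have "(\<integral>x. indicator (A \<inter> P) x * v x \<partial>M) = (\<integral>x. indicator A x * max 0 (v x) \<partial>M)"
          by (intro Bochner_Integration.integral_cong) (auto simp: indicator_def P_def)
        ultimately show "ennreal (\<integral>x. indicator A x * max 0 (v x) \<partial>M) \<le>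
          (SUP B\<in>{B \<in> sets unit_borel. B \<subseteq> A}. ennreal (\<integral>x. indicator B x * v x \<partial>M))"
          by (simp only:)
      qed
    qed
    also have "\<dots> = density M (\<lambda>x. max 0 (v x))"
      using measure_of_of_measure[of "density M (\<lambda>x. max 0 (v x))"]
      by (simp add: space_M sets_M)
    finally show ?thesis .
  qed
  have neg: "(\<lambda>A. - \<nu> A) = (\<lambda>A. \<integral>x. indicator A x * (- w x) \<partial>M)"
    by (simp add: \<nu>_def)
  \<comment> \<open>Each part is dominated pointwise by |\<phi> w|, so integrability of \<phi>
    against both variations follows without assuming \<phi> bounded.\<close>
  have int: "integrable M (\<lambda>x. max 0 (w x) * \<phi> x)" "integrable M (\<lambda>x. max 0 (- w x) * \<phi> x)"
    by (rule Bochner_Integration.integrable_bound[OF \<phi>(1)]; auto intro!: AE_I2 simp: max_def abs_mult mult.commute mult_nonpos_nonneg)+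
  have "signed_integral \<nu> \<phi> =
      (\<integral>x. \<phi> x \<partial>density M (\<lambda>x. max 0 (w x))) - (\<integral>x. \<phi> x \<partial>density M (\<lambda>x. max 0 (- w x)))"
    unfolding signed_integral_def negative_variation_def neg unfolding \<nu>_def
    by (simp only: pv[OF w] pv[OF Bochner_Integration.integrable_minus[OF w]])
  also have "\<dots> = (\<integral>x. max 0 (w x) * \<phi> x \<partial>M) - (\<integral>x. max 0 (- w x) * \<phi> x \<partial>M)"
    by (subst (1 2) integral_density) auto
  also have "\<dots> = (\<integral>x. \<phi> x * w x \<partial>M)"
    by (subst Bochner_Integration.integral_diff[symmetric, OF int])
       (auto intro!: Bochner_Integration.integral_cong simp: max_def)
  finally show "signed_integral \<nu> \<phi> = (\<integral>x. \<phi> x * w x \<partial>M)" .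
qed

text \<open>Both measures are absolutely continuous with respect to their sum, so Radon-Nikodym
  applies with Q = M + N. A common reference measure is needed because a design may have atoms while
  the uniform design has none; only relative to Q does a difference such as g dM - h dN have a
  single density.\<close>

lemma common_density:
  assumes "finite_measure M" "finite_measure N" and sets_N: "sets N = sets M"
  obtains Q a b where "finite_measure Q" "sets Q = sets M"
    "a \<in> borel_measurable Q" "b \<in> borel_measurable Q"
    "\<And>x. 0 \<le> (a x :: real)" "\<And>x. 0 \<le> (b x :: real)"
    "M = density Q a" "N = density Q b"
proof -
  define Q where "Q = measure_of (space M) (sets M) (\<lambda>A. emeasure M A + emeasure N A)"
  have sets_Q: "sets Q = sets M" and space_Q: "space Q = space M"
    by (simp_all add: Q_def)
  have Q: "emeasure Q A = emeasure M A + emeasure N A" if "A \<in> sets M" for A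
    unfolding Q_def
  proof (rule emeasure_measure_of_sigma)
    show "countably_additive (sets M) (\<lambda>A. emeasure M A + emeasure N A)"
    proof (rule countably_additiveI)
      fix A :: "nat \<Rightarrow> _"
      assume "range A \<subseteq> sets M" "disjoint_family A"
      then show "(\<Sum>i. emeasure M (A i) + emeasure N (A i)) = emeasure M (\<Union>i. A i) + emeasure N (\<Union>i. A i)"
        by (subst suminf_add[symmetric]) (auto simp: suminf_emeasure sets_N)
    qed
  qed (use that in \<open>auto simp: positive_def sets.sigma_algebra_axioms\<close>)
  have "emeasure M (space M) \<noteq> \<infinity>" "emeasure N (space M) \<noteq> \<infinity>"
    using finite_measure.emeasure_finite[OF assms(1)] finite_measure.emeasure_finite[OF assms(2)]
    by auto
  then have fin: "finite_measure Q"
    by (intro finite_measureI) (simp add: space_Q Q)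
  interpret Q: finite_measure Q by fact
  have dens: "\<exists>a\<in>borel_measurable Q. (\<forall>x. 0 \<le> (a x :: real)) \<and> L = density Q a"
    if L: "finite_measure L" "sets L = sets M" "\<And>A. A \<in> sets M \<Longrightarrow> emeasure L A \<le> emeasure Q A" for L
  proof -
    have ac: "absolutely_continuous Q L"
      unfolding absolutely_continuous_def
    proof
      fix A assume "A \<in> null_sets Q"
      then show "A \<in> null_sets L"
        using L(3)[of A] by (simp add: null_sets_def L(2) sets_Q)
    qed
    have sets_L: "sets L = sets Q" by (simp add: L(2) sets_Q)
    \<comment> \<open>The real-valued form of the derivative exists because L is finite; changing it
      on a null set leaves the density measure unchanged.\<close>
    obtain a where a: "a \<in> borel_measurable Q"
      "AE x in Q. RN_deriv Q L x = ennreal (a x)" "\<And>x. 0 \<le> a x"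
      by (rule Q.real_RN_deriv[OF L(1) ac sets_L]) blast
    have "L = density Q (RN_deriv Q L)"
      using Q.density_RN_deriv[OF ac sets_L] by simp
    also have "\<dots> = density Q a"
      using a by (intro density_cong) auto
    finally show ?thesis using a by blast
  qed
  from dens[OF assms(1)] dens[OF assms(2) sets_N] show ?thesis
    using that[OF fin sets_Q] by (auto simp: Q)
qed

text \<open>Relative to a common reference measure Q with M = a dQ and N = b dQ, the signed measure
  g dM - h dN has density a g - b h. The quantifier over \<phi> stands inside the existential
  because positive definiteness integrates twice against the same \<nu>, with different
  integrands.\<close>

lemma signed_integral_difference:
  fixes g h :: "real \<Rightarrow> real"
  assumes fin: "finite_measure M" "finite_measure N"
    and sets_M: "sets M = sets unit_borel" and sets_N: "sets N = sets unit_borel"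
    and int: "integrable M g" "integrable N h"
  shows "\<exists>\<nu>. signed_measure \<nu> \<and> (\<forall>\<phi>. \<phi> \<in> borel_measurable unit_borel \<longrightarrow>
    integrable M (\<lambda>x. \<phi> x * g x) \<longrightarrow> integrable N (\<lambda>x. \<phi> x * h x) \<longrightarrow>
    signed_integral \<nu> \<phi> = (\<integral>x. \<phi> x * g x \<partial>M) - (\<integral>x. \<phi> x * h x \<partial>N))"
proof -
  obtain Q a b where Q: "finite_measure Q" "sets Q = sets M"
    and [measurable]: "a \<in> borel_measurable Q" "b \<in> borel_measurable Q"
    and nonneg: "\<And>x. 0 \<le> (a x :: real)" "\<And>x. 0 \<le> (b x :: real)"
    and M: "M = density Q a" and N: "N = density Q b"
    using common_density[OF fin] sets_M sets_N by metis
  have sets_Q: "sets Q = sets unit_borel" using Q sets_M by simp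
  define w where "w x = a x * g x - b x * h x" for x
  have g: "g \<in> borel_measurable Q" and h: "h \<in> borel_measurable Q"
    using borel_measurable_integrable[OF int(1)] borel_measurable_integrable[OF int(2)]
    by (simp_all add: M N)
  note [measurable] = g h
  have main: "integrable Q (\<lambda>x. \<phi> x * w x) \<and>
      (\<integral>x. \<phi> x * w x \<partial>Q) = (\<integral>x. \<phi> x * g x \<partial>M) - (\<integral>x. \<phi> x * h x \<partial>N)"
    if [measurable]: "\<phi> \<in> borel_measurable Q"
      and int: "integrable M (\<lambda>x. \<phi> x * g x)" "integrable N (\<lambda>x. \<phi> x * h x)" for \<phi>
  proof -
    have 1: "integrable Q (\<lambda>x. a x * (\<phi> x * g x))"
      using int(1) nonneg by (simp add: M integrable_density)
    have 2: "integrable Q (\<lambda>x. b x * (\<phi> x * h x))"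
      using int(2) nonneg by (simp add: N integrable_density)
    have eq: "(\<lambda>x. \<phi> x * w x) = (\<lambda>x. a x * (\<phi> x * g x) - b x * (\<phi> x * h x))"
      by (simp add: w_def algebra_simps)
    show ?thesis
      unfolding eq using 1 2 nonneg by (simp add: M N integral_density)
  qed
  \<comment> \<open>The constant test function 1 reduces integrability of w to that of g and
    h.\<close>
  have w: "integrable Q w"
    using main[of "\<lambda>_. 1"] int by simp
  show ?thesis
  proof (intro exI[of _ "\<lambda>A. \<integral>x. indicator A x * w x \<partial>Q"] conjI allI impI)
    show "signed_measure (\<lambda>A. \<integral>x. indicator A x * w x \<partial>Q)"
      using signed_integral_density(1)[OF Q(1) sets_Q w, of "\<lambda>_. 1"] w by simp
  next
    fix \<phi> :: "real \<Rightarrow> real"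
    assume \<phi>: "\<phi> \<in> borel_measurable unit_borel"
      "integrable M (\<lambda>x. \<phi> x * g x)" "integrable N (\<lambda>x. \<phi> x * h x)"
    have "\<phi> \<in> borel_measurable Q"
      using \<phi>(1) measurable_cong_sets[OF sets_Q refl] by blast
    note \<phi>' = main[OF this \<phi>(2,3)] this
    show "signed_integral (\<lambda>A. \<integral>x. indicator A x * w x \<partial>Q) \<phi> =
      (\<integral>x. \<phi> x * g x \<partial>M) - (\<integral>x. \<phi> x * h x \<partial>N)"
      using signed_integral_density(2)[OF Q(1) sets_Q w conjunct1[OF \<phi>'(1)] \<phi>'(2)] conjunct2[OF \<phi>'(1)]
      by (rule trans)
  qed
qed

subsection \<open>Integrals over the unit interval\<close>

lemma space_uniform_design: "space uniform_design = {0..1}"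
  by (simp add: uniform_design_def space_restrict_space)

lemma sets_uniform_design: "sets uniform_design = sets unit_borel"
  by (simp add: uniform_design_def sets_restrict_space)

text \<open>The normalising constant is the Lebesgue measure of [0,1], which is 1.\<close>

lemma uniform_design_eq: "uniform_design = restrict_space lborel {0..1}"
proof -
  have e: "emeasure (restrict_space lborel {0..1::real}) {0..1} = 1"
    by (subst emeasure_restrict_space) auto
  show ?thesis
    unfolding uniform_design_def
  proof (rule measure_eqI)
    fix A assume "A \<in> sets (uniform_measure (restrict_space lborel {0..1::real}) {0..1})"
    then have A: "A \<in> sets (restrict_space lborel {0..1::real})" by simp
    have "{0..1} \<inter> A = A"
      using sets.sets_into_space[OF A] by (auto simp: space_restrict_space)
    moreover have "{0..1} \<in> sets (restrict_space lborel {0..1::real})"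
      by (auto simp: sets_restrict_space)
    ultimately show "emeasure (uniform_measure (restrict_space lborel {0..1}) {0..1}) A =
      emeasure (restrict_space lborel {0..1}) A"
      using A by (simp add: e divide_ennreal_def)
  qed simp
qed

lemma design_uniform: "design uniform_design"
  unfolding design_def
proof
  show "prob_space uniform_design"
    by (rule prob_spaceI) (simp add: uniform_design_eq emeasure_restrict_space space_restrict_space)
qed (rule sets_uniform_design)

lemma integral_uniform_design:
  fixes g :: "real \<Rightarrow> real"
  assumes "continuous_on {0..1} g"
  shows "(\<integral>x. g x \<partial>uniform_design) = integral {0..1} g"
proof -
  have "(\<integral>x. g x \<partial>uniform_design) = (LINT x:{0..1}|lborel. g x)"
    by (simp add: uniform_design_eq integral_restrict_space set_lebesgue_integral_def)
  also have "\<dots> = integral {0..1} g"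
    by (intro set_borel_integral_eq_integral borel_integrable_atLeastAtMost' assms)
  finally show ?thesis .
qed

lemma design_finite_measure: "design \<xi> \<Longrightarrow> finite_measure \<xi>"
  by (simp add: design_def prob_space_def)

lemma design_space: "design \<xi> \<Longrightarrow> space \<xi> = {0..1}"
  unfolding design_def by (metis sets_eq_imp_space_eq space_restrict_space Int_UNIV_right space_borel)

lemma integrable_design_bounded:
  fixes g :: "real \<Rightarrow> real"
  assumes \<xi>: "design \<xi>" and g: "g \<in> borel_measurable unit_borel"
    and bound: "\<And>x. x \<in> {0..1} \<Longrightarrow> \<bar>g x\<bar> \<le> C"
  shows "integrable \<xi> g"
proof (rule finite_measure.integrable_const_bound[where B = C, OF design_finite_measure[OF \<xi>]])
  show "g \<in> borel_measurable \<xi>"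
    using g \<xi> measurable_cong_sets unfolding design_def by blast
qed (use bound in \<open>auto simp: design_space[OF \<xi>] intro!: AE_I2\<close>)

lemma continuous_measurable_unit:
  fixes g :: "real \<Rightarrow> real"
  assumes "continuous_on UNIV g"
  shows "g \<in> borel_measurable unit_borel"
  using assms by (intro measurable_restrict_space1 borel_measurable_continuous_onI)

lemma integrable_design_continuous:
  fixes g :: "real \<Rightarrow> real"
  assumes \<xi>: "design \<xi>" and g: "continuous_on UNIV g"
  shows "integrable \<xi> g"
proof -
  have "compact (g ` {0..1})"
    using g by (intro compact_continuous_image) (auto intro: continuous_on_subset)
  then obtain C where "\<forall>y \<in> g ` {0..1}. norm y \<le> C"
    using compact_imp_bounded bounded_iff by blast
  then have "\<And>x. x \<in> {0..1} \<Longrightarrow> \<bar>g x\<bar> \<le> C" by simp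
  then show ?thesis
    using integrable_design_bounded[OF \<xi> continuous_measurable_unit[OF g]] by blast
qed

lemma integrable_pair_design_continuous:
  fixes F :: "real \<times> real \<Rightarrow> real"
  assumes \<xi>: "design \<xi>" and \<eta>: "design \<eta>" and F: "continuous_on UNIV F"
  shows "integrable (\<xi> \<Otimes>\<^sub>M \<eta>) F"
proof -
  interpret \<xi>: prob_space \<xi> using \<xi> by (simp add: design_def)
  interpret \<eta>: prob_space \<eta> using \<eta> by (simp add: design_def)
  interpret P: pair_prob_space \<xi> \<eta> ..
  have "compact (F ` ({0..1} \<times> {0..1}))"
    using F by (intro compact_continuous_image compact_Times) (auto intro: continuous_on_subset)
  then obtain C where C: "\<forall>y \<in> F ` ({0..1} \<times> {0..1}). norm y \<le> C"
    using compact_imp_bounded bounded_iff by blast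
  show ?thesis
  proof (rule P.integrable_const_bound[where B = C])
    have id: "(\<lambda>x. x) \<in> borel_measurable \<zeta>" if "design \<zeta>" for \<zeta>
      using that measurable_cong_sets[of \<zeta> unit_borel borel borel]
      by (auto simp: design_def intro!: measurable_restrict_space1)
    \<comment> \<open>Continuity yields measurability of F on the plane; composing with this
      identity map transfers it to the product of the two designs, whose sets are traces on
      [0,1].\<close>
    have [measurable]: "(\<lambda>p. p) \<in> \<xi> \<Otimes>\<^sub>M \<eta> \<rightarrow>\<^sub>M borel \<Otimes>\<^sub>M borel"
      using measurable_compose[OF measurable_fst id[OF \<xi>]]
        measurable_compose[OF measurable_snd id[OF \<eta>]]
      by (intro measurable_pair) (auto simp: comp_def)
    have "F \<in> borel_measurable (borel \<Otimes>\<^sub>M borel)"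
      unfolding borel_prod using F by (rule borel_measurable_continuous_onI)
    from measurable_compose[OF \<open>(\<lambda>p. p) \<in> _\<close> this] show "F \<in> borel_measurable (\<xi> \<Otimes>\<^sub>M \<eta>)"
      by simp
  qed (use C in \<open>auto simp: space_pair_measure design_space[OF \<xi>] design_space[OF \<eta>] intro!: AE_I2\<close>)
qed

text \<open>Designs are probability measures and F is bounded on the unit square, so Fubini applies.
  The first order of integration, u inside and v outside, matches the nesting in
  \<open>positive_definite_kernel\<close>; the third claim supplies integrability of the
  potentials.\<close>

lemma design_Fubini:
  fixes F :: "real \<Rightarrow> real \<Rightarrow> real"
  assumes \<xi>: "design \<xi>" and \<eta>: "design \<eta>" and F: "continuous_on UNIV (\<lambda>(u, v). F u v)"
  shows "(\<integral>(u, v). F u v \<partial>(\<xi> \<Otimes>\<^sub>M \<eta>)) = (\<integral>v. (\<integral>u. F u v \<partial>\<xi>) \<partial>\<eta>)"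
    and "(\<integral>(u, v). F u v \<partial>(\<xi> \<Otimes>\<^sub>M \<eta>)) = (\<integral>u. (\<integral>v. F u v \<partial>\<eta>) \<partial>\<xi>)"
    and "integrable \<eta> (\<lambda>v. \<integral>u. F u v \<partial>\<xi>)"
proof -
  interpret \<xi>: prob_space \<xi> using \<xi> by (simp add: design_def)
  interpret \<eta>: prob_space \<eta> using \<eta> by (simp add: design_def)
  interpret P: pair_prob_space \<xi> \<eta> ..
  note int = integrable_pair_design_continuous[OF \<xi> \<eta> F]
  show "(\<integral>(u, v). F u v \<partial>(\<xi> \<Otimes>\<^sub>M \<eta>)) = (\<integral>v. (\<integral>u. F u v \<partial>\<xi>) \<partial>\<eta>)"
    using P.integral_snd[OF int] by simp
  show "(\<integral>(u, v). F u v \<partial>(\<xi> \<Otimes>\<^sub>M \<eta>)) = (\<integral>u. (\<integral>v. F u v \<partial>\<eta>) \<partial>\<xi>)"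
    using P.integral_fst'[OF int] by simp
  show "integrable \<eta> (\<lambda>v. \<integral>u. F u v \<partial>\<xi>)"
    using P.integrable_snd[OF int] by simp
qed

subsection \<open>Trigonometric functions and periodic kernels\<close>

text \<open>For nonzero k the antiderivative is a multiple of a sine vanishing at both endpoints.
  The frequency is an integer because it will be a difference of two natural numbers.\<close>

lemma integral_cos_periods:
  fixes k :: int
  shows "integral {0..1} (\<lambda>x. cos (2 * pi * real_of_int k * x)) = (if k = 0 then 1 else 0)"
proof (cases "k = 0")
  case False
  have "((\<lambda>x. cos (2 * pi * real_of_int k * x)) has_integral
    sin (2 * pi * real_of_int k * 1) / (2 * pi * real_of_int k)
      - sin (2 * pi * real_of_int k * 0) / (2 * pi * real_of_int k)) {0..1}"
    using False
    by (intro fundamental_theorem_of_calculus)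
       (auto intro!: derivative_eq_intros simp flip: has_real_derivative_iff_has_vector_derivative)
  moreover have "sin (2 * pi * real_of_int k) = 0"
    by (simp add: sin_integer_2pi)
  ultimately show ?thesis
    using False by (simp add: integral_unique)
qed simp

text \<open>With frequency n = j - 1 the constant function is a cosine too, of frequency 0, so the
  two cases differ only in the normalising factor.\<close>

lemma cosine_fn_Suc:
  "cosine_fn (Suc n) x = (if n = 0 then 1 else sqrt 2) * cos (2 * pi * real n * x)"
  by (simp add: cosine_fn_def)

lemma continuous_on_cosine_fn [continuous_intros]:
  fixes g :: "'a::t2_space \<Rightarrow> real"
  shows "continuous_on A g \<Longrightarrow> continuous_on A (\<lambda>x. cosine_fn j (g x))"
  unfolding cosine_fn_def by (cases "j = 1"; simp; intro continuous_intros)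

text \<open>The product-to-sum formula leaves cosines of the integer frequencies n - m and n + m,
  which integrate to 0 unless the frequency is 0.\<close>

lemma cosine_fn_orthonormal:
  assumes "1 \<le> j" "1 \<le> k"
  shows "(\<integral>x. cosine_fn j x * cosine_fn k x \<partial>uniform_design) = (if j = k then 1 else 0)"
proof -
  obtain n m where nm: "j = Suc n" "k = Suc m"
    using assms by (cases j; cases k) auto
  define c where "c l = (if l = 0 then 1 else sqrt 2)" for l :: nat
  have eq: "(\<lambda>x. cosine_fn j x * cosine_fn k x) = (\<lambda>x. c n * c m / 2 *
      (cos (2 * pi * real_of_int (int n - int m) * x) + cos (2 * pi * real_of_int (int n + int m) * x)))"
  proof
    fix x
    have "cos (2 * pi * real n * x) * cos (2 * pi * real m * x) =
        (cos (2 * pi * real_of_int (int n - int m) * x) + cos (2 * pi * real_of_int (int n + int m) * x)) / 2"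
      by (subst cos_times_cos) (simp add: algebra_simps)
    then show "cosine_fn j x * cosine_fn k x = c n * c m / 2 *
      (cos (2 * pi * real_of_int (int n - int m) * x) + cos (2 * pi * real_of_int (int n + int m) * x))"
      unfolding nm cosine_fn_Suc c_def by (simp add: mult_ac)
  qed
  have "(\<integral>x. cosine_fn j x * cosine_fn k x \<partial>uniform_design)
    = integral {0..1} (\<lambda>x. cosine_fn j x * cosine_fn k x)"
    by (intro integral_uniform_design continuous_intros)
  also have "\<dots> = c n * c m / 2 *
      (integral {0..1} (\<lambda>x. cos (2 * pi * real_of_int (int n - int m) * x)) +
       integral {0..1} (\<lambda>x. cos (2 * pi * real_of_int (int n + int m) * x)))"
    unfolding eq
    by (subst integral_mult_right, subst Henstock_Kurzweil_Integration.integral_add)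
       ((intro integrable_continuous_interval continuous_intros)+, rule refl)
  \<comment> \<open>If n = m = 0, both integrals are 1 and the prefactor is 1/2; if n = m > 0, only
    the difference frequency survives and the prefactor is 1.\<close>
  also have "\<dots> = (if j = k then 1 else 0)"
    unfolding integral_cos_periods by (auto simp: nm c_def)
  finally show ?thesis .
qed

text \<open>The shifted interval [-v, 1 - v] is cut at 0, and its left piece is moved by one period
  to [1 - v, 1].\<close>

lemma integral_periodic_shift:
  fixes g :: "real \<Rightarrow> real"
  assumes g: "continuous_on UNIV g" and per: "\<And>t. g (t + 1) = g t" and v: "v \<in> {0..1}"
  shows "integral {0..1} (\<lambda>u. g (u - v)) = integral {0..1} g"
proof -
  have cont: "continuous_on A g" for A using g by (rule continuous_on_subset) simp
  have io: "g integrable_on {a..b}" for a b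
    by (intro integrable_continuous_interval cont)
  have "integral {0..1} (\<lambda>u. g (u - v)) = integral {- v..1 - v} g"
    using integral_shift[of 0 "- v" 1 g] cont by (simp add: comp_def)
  also have "\<dots> = integral {- v..0} g + integral {0..1 - v} g"
    using v by (intro Henstock_Kurzweil_Integration.integral_combine[symmetric] io) auto
  also have "integral {- v..0} g = integral {1 - v..1} g"
    using integral_shift[of "- v" 1 0 g] cont per by (simp add: comp_def)
  also have "integral {1 - v..1} g + integral {0..1 - v} g = integral {0..1} g"
    using v Henstock_Kurzweil_Integration.integral_combine[OF _ _ io, of 0 "1 - v" 1] by simp
  finally show ?thesis .
qed

text \<open>Reflection carries [0,1] to [-1,0], which is again a full period. This serves to
  eliminate the sine coefficients of an even periodic function.\<close>

lemma integral_periodic_reflect: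
  fixes g :: "real \<Rightarrow> real"
  assumes g: "continuous_on UNIV g" and per: "\<And>t. g (t + 1) = g t"
  shows "integral {0..1} (\<lambda>u. g (- u)) = integral {0..1} g"
proof -
  have cont: "continuous_on A g" for A using g by (rule continuous_on_subset) simp
  have "integral {0..1} (\<lambda>u. g (- u)) = integral {- 1..0} g"
    using Henstock_Kurzweil_Integration.integral_reflect_real[of 0 "-1" g] by simp
  also have "\<dots> = integral {0..1} g"
    using integral_shift[of "- 1" 1 0 g] cont per by (simp add: comp_def)
  finally show ?thesis .
qed

text \<open>The integral is a convolution over a full period. Expanding the cosine around u - v
  separates v from the integration, and the sine coefficient of \<rho> vanishes by evenness, so only
  a multiple of the same cosine remains; the eigenvalue is the cosine coefficient of \<rho>.\<close>

lemma cosine_fn_eigenfunction: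
  assumes \<rho>: "continuous_on UNIV \<rho>" and even: "\<And>t. \<rho> (- t) = \<rho> t"
    and per: "\<And>t. \<rho> (t + 1) = \<rho> t" and j: "1 \<le> j" and v: "v \<in> {0..1}"
  shows "(\<integral>u. \<rho> (u - v) * cosine_fn j u \<partial>uniform_design) =
    integral {0..1} (\<lambda>t. \<rho> t * cos (2 * pi * (real j - 1) * t)) * cosine_fn j v"
proof -
  obtain n where n: "j = Suc n"
    using j by (cases j) auto
  define c where "c = (if n = 0 then 1 else sqrt 2)"
  let ?w = "2 * pi * real n"
  have \<rho>_comp: "continuous_on A (\<lambda>x. \<rho> (f x))" if "continuous_on A f" for A and f :: "real \<Rightarrow> real"
    by (rule continuous_on_compose2[OF \<rho> that]) simp
  have shift: "sin (?w * (t + 1)) = sin (?w * t)" "cos (?w * (t + 1)) = cos (?w * t)" for t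
  proof -
    have "?w * (t + 1) = ?w * t + 2 * real n * pi"
      by (simp add: algebra_simps)
    then show "sin (?w * (t + 1)) = sin (?w * t)" "cos (?w * (t + 1)) = cos (?w * t)"
      by (simp_all only: sin_add cos_add sin_2npi cos_2npi)
  qed
  \<comment> \<open>As \<rho> is even and sine is odd, the left side is the negative of the right
    side, so both are 0.\<close>
  have "integral {0..1} (\<lambda>t. \<rho> (- t) * sin (?w * (- t))) = integral {0..1} (\<lambda>t. \<rho> t * sin (?w * t))"
    by (rule integral_periodic_reflect[of "\<lambda>t. \<rho> t * sin (?w * t)"])
       (intro continuous_intros \<rho>_comp, simp only: per shift)
  then have sin0: "integral {0..1} (\<lambda>t. \<rho> t * sin (?w * t)) = 0"
    by (simp add: even)
  have eq: "\<rho> (u - v) * cosine_fn j u =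
      c * cos (?w * v) * (\<rho> (u - v) * cos (?w * (u - v))) - c * sin (?w * v) * (\<rho> (u - v) * sin (?w * (u - v)))" for u
  proof -
    have "cos (?w * u) = cos (?w * (u - v) + ?w * v)"
      by (simp add: algebra_simps)
    then have "cos (?w * u) = cos (?w * (u - v)) * cos (?w * v) - sin (?w * (u - v)) * sin (?w * v)"
      by (simp only: cos_add)
    then show ?thesis
      unfolding n cosine_fn_Suc c_def[symmetric] by (simp only:) (simp add: algebra_simps)
  qed
  have "(\<integral>u. \<rho> (u - v) * cosine_fn j u \<partial>uniform_design) =
    integral {0..1} (\<lambda>u. \<rho> (u - v) * cosine_fn j u)"
    by (intro integral_uniform_design continuous_intros \<rho>_comp)
  also have "\<dots> = c * cos (?w * v) * integral {0..1} (\<lambda>u. \<rho> (u - v) * cos (?w * (u - v)))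
      - c * sin (?w * v) * integral {0..1} (\<lambda>u. \<rho> (u - v) * sin (?w * (u - v)))"
    unfolding eq
    by (subst Henstock_Kurzweil_Integration.integral_diff)
       ((intro integrable_continuous_interval continuous_intros \<rho>_comp)+, simp)
  also have "integral {0..1} (\<lambda>u. \<rho> (u - v) * cos (?w * (u - v))) = integral {0..1} (\<lambda>t. \<rho> t * cos (?w * t))"
    by (rule integral_periodic_shift[of "\<lambda>t. \<rho> t * cos (?w * t)", OF _ _ v])
       (intro continuous_intros \<rho>_comp, simp only: per shift)
  also have "integral {0..1} (\<lambda>u. \<rho> (u - v) * sin (?w * (u - v))) = integral {0..1} (\<lambda>t. \<rho> t * sin (?w * t))"
    by (rule integral_periodic_shift[of "\<lambda>t. \<rho> t * sin (?w * t)", OF _ _ v])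
       (intro continuous_intros \<rho>_comp, simp only: per shift)
  finally show ?thesis
    by (simp add: sin0 n cosine_fn_Suc c_def)
qed

subsection \<open>The energy inequality\<close>

text \<open>Let S be the left-hand sum. The signed measure g d\<xi> - h du, with h the cosine sum
  with coefficients \<open>x k\<close>, has energy E - 2 S + S, where E is the energy of g d\<xi>:
  the mixed energy and the energy of h du both equal S. Positive definiteness then gives E - S \<ge>
  0. Here \<open>x\<close> stands for the vector M(\<xi>) y.\<close>

lemma cosine_energy_bound:
  fixes \<rho> :: "real \<Rightarrow> real" and i :: "'m::finite \<Rightarrow> nat" and y :: "'m \<Rightarrow> real"
  assumes \<rho>: "correlation_function \<rho>" and per: "\<And>t. \<rho> (t + 1) = \<rho> t"
    and inj: "inj i" and i: "\<And>k. 1 \<le> i k" and \<xi>: "design \<xi>"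
  defines "g \<equiv> \<lambda>u. \<Sum>k\<in>UNIV. y k * cosine_fn (i k) u"
    and "l \<equiv> \<lambda>k. integral {0..1} (\<lambda>t. \<rho> t * cos (2 * pi * (real (i k) - 1) * t))"
    and "x \<equiv> \<lambda>k. \<Sum>j\<in>UNIV. y j * (\<integral>u. cosine_fn (i k) u * cosine_fn (i j) u \<partial>\<xi>)"
  shows "(\<Sum>k\<in>UNIV. l k * (x k)\<^sup>2) \<le> (\<integral>(u, v). \<rho> (u - v) * g u * g v \<partial>(\<xi> \<Otimes>\<^sub>M \<xi>))"
proof -
  let ?U = uniform_design
  note U = design_uniform
  have even: "\<rho> (- t) = \<rho> t" and cont: "continuous_on UNIV \<rho>"
    and pd: "positive_definite_kernel (\<lambda>u v. \<rho> (u - v))" for t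
    using \<rho> by (auto simp: correlation_function_def)
  have \<rho>_comp: "continuous_on A (\<lambda>x. \<rho> (f x))" if "continuous_on A f"
    for A :: "'c::t2_space set" and f :: "'c \<Rightarrow> real"
    by (rule continuous_on_compose2[OF cont that]) simp
  \<comment> \<open>The coefficients are the moments of g d\<xi>, so by orthonormality h du has the
    same moments against the chosen cosines.\<close>
  define h where "h u = (\<Sum>k\<in>UNIV. x k * cosine_fn (i k) u)" for u
  \<comment> \<open>H is the closed form, through the eigenvalues, of the potential of h du.\<close>
  define H where "H u = (\<Sum>k\<in>UNIV. l k * x k * cosine_fn (i k) u)" for u
  have gc: "continuous_on A (\<lambda>x. g (f x))" and hc: "continuous_on A (\<lambda>x. h (f x))"
    if "continuous_on A f" for A :: "'c::t2_space set" and f :: "'c \<Rightarrow> real"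
    unfolding g_def h_def by (intro continuous_intros that; simp)+
  \<comment> \<open>A and C are the potentials of g d\<xi> and of h du. No closed form of A is
    required.\<close>
  define A where "A v = (\<integral>u. \<rho> (u - v) * g u \<partial>\<xi>)" for v
  define C where "C v = (\<integral>u. \<rho> (u - v) * h u \<partial>?U)" for v

  \<comment> \<open>The eigenfunction identity is available for v in [0,1], which is enough because
    both designs live there.\<close>
  have C_eq: "C v = H v" if "v \<in> {0..1}" for v
  proof -
    have "C v = (\<integral>u. (\<Sum>k\<in>UNIV. x k * (\<rho> (u - v) * cosine_fn (i k) u)) \<partial>?U)"
      by (simp add: C_def h_def sum_distrib_left mult_ac)
    also have "\<dots> = (\<Sum>k\<in>UNIV. x k * (\<integral>u. \<rho> (u - v) * cosine_fn (i k) u \<partial>?U))"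
      by (subst Bochner_Integration.integral_sum)
         (intro integrable_design_continuous[OF U] continuous_intros \<rho>_comp, simp)
    also have "\<dots> = H v"
      unfolding cosine_fn_eigenfunction[OF cont even per i that] H_def l_def by (simp add: mult_ac)
    finally show ?thesis .
  qed

  have Hg: "(\<integral>v. H v * g v \<partial>\<xi>) = (\<Sum>k\<in>UNIV. l k * (x k)\<^sup>2)"
  proof -
    have "(\<integral>v. H v * g v \<partial>\<xi>) = (\<integral>v. (\<Sum>k\<in>UNIV. \<Sum>j\<in>UNIV. l k * x k * y j * (cosine_fn (i k) v * cosine_fn (i j) v)) \<partial>\<xi>)"
      unfolding H_def g_def sum_product by (simp add: mult_ac)
    also have "\<dots> = (\<Sum>k\<in>UNIV. \<Sum>j\<in>UNIV. l k * x k * y j * (\<integral>v. cosine_fn (i k) v * cosine_fn (i j) v \<partial>\<xi>))"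
      by (simp add: Bochner_Integration.integral_sum integrable_design_continuous[OF \<xi>]
          continuous_on_mult continuous_on_cosine_fn)
    also have "\<dots> = (\<Sum>k\<in>UNIV. l k * (x k)\<^sup>2)"
      by (simp add: x_def power2_eq_square sum_distrib_left mult_ac)
    finally show ?thesis .
  qed

  have Hh: "(\<integral>v. H v * h v \<partial>?U) = (\<Sum>k\<in>UNIV. l k * (x k)\<^sup>2)"
  proof -
    have "(\<integral>v. H v * h v \<partial>?U) = (\<integral>v. (\<Sum>k\<in>UNIV. \<Sum>j\<in>UNIV. l k * x k * x j * (cosine_fn (i k) v * cosine_fn (i j) v)) \<partial>?U)"
      unfolding H_def h_def sum_product by (simp add: mult_ac)
    also have "\<dots> = (\<Sum>k\<in>UNIV. \<Sum>j\<in>UNIV. l k * x k * x j * (\<integral>v. cosine_fn (i k) v * cosine_fn (i j) v \<partial>?U))"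
      by (simp add: Bochner_Integration.integral_sum integrable_design_continuous[OF U]
          continuous_on_mult continuous_on_cosine_fn)
    also have "\<dots> = (\<Sum>k\<in>UNIV. \<Sum>j\<in>UNIV. l k * x k * x j * (if j = k then 1 else 0))"
      using inj by (intro sum.cong refl) (auto simp: cosine_fn_orthonormal[OF i i] inj_eq)
    also have "\<dots> = (\<Sum>k\<in>UNIV. l k * (x k)\<^sup>2)"
      by (simp add: power2_eq_square mult_ac if_distrib cong: if_cong)
    finally show ?thesis .
  qed

  have Ag: "(\<integral>v. A v * g v \<partial>\<xi>) = (\<integral>(u, v). \<rho> (u - v) * g u * g v \<partial>(\<xi> \<Otimes>\<^sub>M \<xi>))"
    and Ag_int: "integrable \<xi> (\<lambda>v. A v * g v)"
  proof -
    have c: "continuous_on UNIV (\<lambda>(u, v). \<rho> (u - v) * g u * g v)"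
      unfolding case_prod_unfold by (intro continuous_intros \<rho>_comp gc)
    show "(\<integral>v. A v * g v \<partial>\<xi>) = (\<integral>(u, v). \<rho> (u - v) * g u * g v \<partial>(\<xi> \<Otimes>\<^sub>M \<xi>))"
      using design_Fubini(1)[OF \<xi> \<xi> c] by (simp add: A_def)
    show "integrable \<xi> (\<lambda>v. A v * g v)"
      using design_Fubini(3)[OF \<xi> \<xi> c] by (simp add: A_def)
  qed
  \<comment> \<open>Fubini and evenness of \<rho> make the mixed energy symmetric, so the potential
    A is traded for C, which is explicit.\<close>
  have Ah: "(\<integral>v. A v * h v \<partial>?U) = (\<integral>u. C u * g u \<partial>\<xi>)"
    and Ah_int: "integrable ?U (\<lambda>v. A v * h v)"
  proof -
    have c: "continuous_on UNIV (\<lambda>(u, v). \<rho> (u - v) * g u * h v)"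
      unfolding case_prod_unfold by (intro continuous_intros \<rho>_comp gc hc)
    have "(\<integral>v. A v * h v \<partial>?U) = (\<integral>u. (\<integral>v. \<rho> (u - v) * g u * h v \<partial>?U) \<partial>\<xi>)"
      using design_Fubini(1,2)[OF \<xi> U c] by (simp add: A_def)
    also have "\<dots> = (\<integral>u. C u * g u \<partial>\<xi>)"
    proof (intro Bochner_Integration.integral_cong refl)
      fix u
      have "(\<lambda>v. \<rho> (u - v) * g u * h v) = (\<lambda>v. \<rho> (v - u) * h v * g u)"
        using even[of "_ - u"] by (auto simp: fun_eq_iff)
      then show "(\<integral>v. \<rho> (u - v) * g u * h v \<partial>?U) = C u * g u"
        by (simp add: C_def)
    qed
    finally show "(\<integral>v. A v * h v \<partial>?U) = (\<integral>u. C u * g u \<partial>\<xi>)" .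
    show "integrable ?U (\<lambda>v. A v * h v)"
      using design_Fubini(3)[OF \<xi> U c] by (simp add: A_def)
  qed
  have C_int: "integrable \<xi> (\<lambda>v. C v * g v)" "integrable ?U (\<lambda>v. C v * h v)"
  proof -
    have c: "continuous_on UNIV (\<lambda>(u, v). \<rho> (u - v) * h u * g v)"
      "continuous_on UNIV (\<lambda>(u, v). \<rho> (u - v) * h u * h v)"
      unfolding case_prod_unfold by (intro continuous_intros \<rho>_comp gc hc)+
    show "integrable \<xi> (\<lambda>v. C v * g v)" "integrable ?U (\<lambda>v. C v * h v)"
      using design_Fubini(3)[OF U \<xi> c(1)] design_Fubini(3)[OF U U c(2)] by (simp_all add: C_def)
  qed
  \<comment> \<open>The outer test function must be Borel on [0,1]; Fubini against the uniform
    design delivers this measurability for both potentials.\<close>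
  have AC_meas: "(\<lambda>v. A v - C v) \<in> borel_measurable unit_borel"
  proof -
    have c: "continuous_on UNIV (\<lambda>(u, v). \<rho> (u - v) * g u)"
      "continuous_on UNIV (\<lambda>(u, v). \<rho> (u - v) * h u)"
      unfolding case_prod_unfold by (intro continuous_intros \<rho>_comp gc hc)+
    have "(\<lambda>v. A v - C v) \<in> borel_measurable ?U"
      using design_Fubini(3)[OF \<xi> U c(1)] design_Fubini(3)[OF U U c(2)]
      unfolding A_def C_def by (intro borel_measurable_diff borel_measurable_integrable)
    then show ?thesis
      using measurable_cong_sets[OF sets_uniform_design refl] by blast
  qed

  have "sets \<xi> = sets unit_borel" using \<xi> by (simp add: design_def)
  from signed_integral_difference[OF design_finite_measure[OF \<xi>] design_finite_measure[OF U]
      this sets_uniform_design integrable_design_continuous[OF \<xi> gc[OF continuous_on_id]]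
      integrable_design_continuous[OF U hc[OF continuous_on_id]]]
  obtain \<nu> where \<nu>: "signed_measure \<nu>"
    and S: "\<And>\<phi>. \<phi> \<in> borel_measurable unit_borel \<Longrightarrow> integrable \<xi> (\<lambda>x. \<phi> x * g x) \<Longrightarrow>
      integrable ?U (\<lambda>x. \<phi> x * h x) \<Longrightarrow>
      signed_integral \<nu> \<phi> = (\<integral>x. \<phi> x * g x \<partial>\<xi>) - (\<integral>x. \<phi> x * h x \<partial>?U)"
    by auto
  have inner: "signed_integral \<nu> (\<lambda>u. \<rho> (u - v)) = A v - C v" for v
    unfolding A_def C_def
    by (intro S continuous_measurable_unit integrable_design_continuous[OF \<xi>]
        integrable_design_continuous[OF U] continuous_intros \<rho>_comp gc hc)
  have "0 \<le> signed_integral \<nu> (\<lambda>v. A v - C v)"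
    using pd[unfolded positive_definite_kernel_def, rule_format, OF \<nu>] by (simp only: inner)
  \<comment> \<open>Bilinear expansion of the energy into its four terms; the last three are then
    rewritten through H.\<close>
  also have "\<dots> = ((\<integral>v. A v * g v \<partial>\<xi>) - (\<integral>v. C v * g v \<partial>\<xi>)) -
      ((\<integral>v. A v * h v \<partial>?U) - (\<integral>v. C v * h v \<partial>?U))"
    by (subst S[OF AC_meas]) (simp_all add: left_diff_distrib Ag_int Ah_int C_int)
  also have "(\<integral>v. C v * g v \<partial>\<xi>) = (\<integral>v. H v * g v \<partial>\<xi>)"
    by (intro Bochner_Integration.integral_cong) (simp_all add: C_eq design_space[OF \<xi>])
  also have "(\<integral>v. C v * h v \<partial>?U) = (\<integral>v. H v * h v \<partial>?U)"
    by (intro Bochner_Integration.integral_cong) (simp_all add: C_eq design_space[OF U])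
  also have "(\<integral>v. A v * h v \<partial>?U) = (\<integral>v. H v * g v \<partial>\<xi>)"
    unfolding Ah by (intro Bochner_Integration.integral_cong) (simp_all add: C_eq design_space[OF \<xi>])
  finally show ?thesis
    by (simp add: Hg Hh Ag)
qed

subsection \<open>Matrices\<close>

lemma matrix_inv_inverse:
  assumes "invertible A"
  shows "A ** matrix_inv A = mat 1" "matrix_inv A ** A = mat 1"
  using someI_ex[OF assms[unfolded invertible_def]] by (simp_all add: matrix_inv_def)

text \<open>The transposed inverse is a left inverse of the symmetric matrix A, hence equal to the
  inverse.\<close>

lemma transpose_matrix_inv_symmetric:
  fixes A :: "real ^ 'm ^ 'm"
  assumes A: "invertible A" and sym: "transpose A = A"
  shows "transpose (matrix_inv A) = matrix_inv A"
proof -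
  have "transpose (matrix_inv A) ** A = transpose (A ** matrix_inv A)"
    by (simp add: matrix_transpose_mul sym)
  then have "transpose (matrix_inv A) ** A = mat 1"
    by (simp add: matrix_inv_inverse[OF A] transpose_mat)
  then have "(transpose (matrix_inv A) ** A) ** matrix_inv A = matrix_inv A"
    by simp
  then show ?thesis
    by (simp add: matrix_inv_inverse[OF A] flip: matrix_mul_assoc)
qed

lemma inner_symmetric_matrix:
  fixes A :: "real ^ 'm ^ 'm"
  assumes "transpose A = A"
  shows "x \<bullet> (A *v z) = (A *v x) \<bullet> z"
  by (metis assms dot_lmul_matrix transpose_matrix_vector)

lemma inner_matrix_vector_sum:
  fixes A :: "real ^ 'm ^ 'm"
  shows "x \<bullet> (A *v x) = (\<Sum>j\<in>UNIV. \<Sum>k\<in>UNIV. x $ j * x $ k * A $ j $ k)"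
  by (simp add: inner_vec_def matrix_vector_mult_def sum_distrib_left mult_ac)

text \<open>Injectivity of \<open>i\<close> makes the regression functions orthonormal, so M is the
  identity and D is diagonal for the uniform design. The inequality of quadratic forms comes from
  \<open>cosine_energy_bound\<close>; the Loewner order also demands symmetry of the difference,
  hence the symmetry claims for each matrix.\<close>

lemma universally_optimal_cosine:
  fixes \<rho> :: "real \<Rightarrow> real" and i :: "'m::finite \<Rightarrow> nat"
  assumes \<rho>: "correlation_function \<rho>" and per: "\<And>t. \<rho> (t + 1) = \<rho> t"
    and inj: "inj i" and i: "\<And>k. 1 \<le> i k"
  shows "universally_optimal (\<lambda>u v. \<rho> (u - v)) (\<lambda>x. \<chi> k. cosine_fn (i k) x) uniform_design"
proof -
  let ?U = uniform_design and ?K = "\<lambda>u v. \<rho> (u - v)" and ?f = "\<lambda>x. \<chi> k. cosine_fn (i k) x"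
  define l where "l k = integral {0..1} (\<lambda>t. \<rho> t * cos (2 * pi * (real (i k) - 1) * t))" for k
  have even: "\<rho> (- t) = \<rho> t" and cont: "continuous_on UNIV \<rho>" for t
    using \<rho> by (auto simp: correlation_function_def)
  have \<rho>_comp: "continuous_on A (\<lambda>x. \<rho> (f x))" if "continuous_on A f"
    for A :: "'c::t2_space set" and f :: "'c \<Rightarrow> real"
    by (rule continuous_on_compose2[OF cont that]) simp
  have c: "continuous_on UNIV (\<lambda>(u, v). \<rho> (u - v) * cosine_fn (i j) u * cosine_fn (i k) v)" for j k
    unfolding case_prod_unfold by (intro continuous_intros \<rho>_comp)
  have M: "M_matrix ?f \<xi> = (\<chi> j k. \<integral>u. cosine_fn (i j) u * cosine_fn (i k) u \<partial>\<xi>)" for \<xi>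
    by (simp add: M_matrix_def)
  have B: "B_matrix ?K ?f \<xi> = (\<chi> j k. \<integral>(u, v). \<rho> (u - v) * cosine_fn (i j) u * cosine_fn (i k) v \<partial>(\<xi> \<Otimes>\<^sub>M \<xi>))" for \<xi>
    by (simp add: B_matrix_def)
  have MU: "M_matrix ?f ?U = mat 1"
    using inj by (simp add: M mat_def cosine_fn_orthonormal[OF i i] inj_eq)
  have BU: "B_matrix ?K ?f ?U = (\<chi> j k. if j = k then l j else 0)"
  proof -
    have "(\<integral>(u, v). \<rho> (u - v) * cosine_fn (i j) u * cosine_fn (i k) v \<partial>(?U \<Otimes>\<^sub>M ?U)) = (if j = k then l j else 0)"
      for j k
    proof -
      have "(\<integral>(u, v). \<rho> (u - v) * cosine_fn (i j) u * cosine_fn (i k) v \<partial>(?U \<Otimes>\<^sub>M ?U)) =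
        (\<integral>v. (\<integral>u. \<rho> (u - v) * cosine_fn (i j) u \<partial>?U) * cosine_fn (i k) v \<partial>?U)"
        by (simp add: design_Fubini(1)[OF design_uniform design_uniform c])
      also have "\<dots> = (\<integral>v. l j * (cosine_fn (i j) v * cosine_fn (i k) v) \<partial>?U)"
        by (intro Bochner_Integration.integral_cong refl)
           (simp add: design_space[OF design_uniform] cosine_fn_eigenfunction[OF cont even per i] l_def)
      also have "\<dots> = (if j = k then l j else 0)"
        using inj by (simp add: cosine_fn_orthonormal[OF i i] inj_eq)
      finally show ?thesis .
    qed
    then show ?thesis by (simp add: B)
  qed
  have inv1: "matrix_inv (mat 1) = (mat 1 :: real ^ 'm ^ 'm)"
    using matrix_inv_inverse(1)[of "mat 1 :: real ^ 'm ^ 'm"] by (simp add: invertible_def)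
  have DU: "D_matrix ?K ?f ?U = (\<chi> j k. if j = k then l j else 0)"
    by (simp add: D_matrix_def MU inv1 BU)
  have symU: "transpose (D_matrix ?K ?f ?U) = D_matrix ?K ?f ?U"
    by (simp add: DU transpose_def vec_eq_iff)
  have U_quad: "x \<bullet> (D_matrix ?K ?f ?U *v x) = (\<Sum>k\<in>UNIV. l k * (x $ k)\<^sup>2)" for x
    unfolding inner_matrix_vector_sum DU
    by (simp add: power2_eq_square mult_ac if_distrib cong: if_cong)

  have "?U \<in> admissible_designs ?K ?f"
  proof -
    have "integrable (?U \<Otimes>\<^sub>M ?U) (\<lambda>(u, v). \<rho> (u - v) * cosine_fn (i j) u * cosine_fn (i k) v)"
      "integrable ?U (\<lambda>u. cosine_fn (i j) u * cosine_fn (i k) u)" for j k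
      by (intro integrable_pair_design_continuous integrable_design_continuous design_uniform c continuous_intros)+
    then show ?thesis
      by (simp add: admissible_designs_def design_uniform MU invertible_def)
  qed
  moreover have "loewner_le (D_matrix ?K ?f ?U) (D_matrix ?K ?f \<xi>)"
    if "\<xi> \<in> admissible_designs ?K ?f" for \<xi>
  proof -
    have \<xi>: "design \<xi>" and inv: "invertible (M_matrix ?f \<xi>)"
      using that by (auto simp: admissible_designs_def)
    let ?M = "M_matrix ?f \<xi>" and ?B = "B_matrix ?K ?f \<xi>"
    let ?N = "matrix_inv ?M"
    have symM: "transpose ?M = ?M"
      by (simp add: M transpose_def mult.commute)
    note symN = transpose_matrix_inv_symmetric[OF inv symM]
    \<comment> \<open>Exchanging the roles of u and v uses both orders of integration together with
      evenness of \<rho>.\<close>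
    have symB: "transpose ?B = ?B"
    proof -
      have "(\<integral>(u, v). \<rho> (u - v) * cosine_fn (i k) u * cosine_fn (i j) v \<partial>(\<xi> \<Otimes>\<^sub>M \<xi>)) =
        (\<integral>(u, v). \<rho> (u - v) * cosine_fn (i j) u * cosine_fn (i k) v \<partial>(\<xi> \<Otimes>\<^sub>M \<xi>))" for j k
      proof -
        have *: "\<rho> (u - v) * cosine_fn (i k) u * cosine_fn (i j) v = \<rho> (v - u) * cosine_fn (i j) v * cosine_fn (i k) u"
          for u v
          using even[of "v - u"] by simp
        have "(\<integral>(u, v). \<rho> (u - v) * cosine_fn (i k) u * cosine_fn (i j) v \<partial>(\<xi> \<Otimes>\<^sub>M \<xi>)) =
          (\<integral>u. (\<integral>v. \<rho> (u - v) * cosine_fn (i k) u * cosine_fn (i j) v \<partial>\<xi>) \<partial>\<xi>)"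
          by (rule design_Fubini(2)[OF \<xi> \<xi> c])
        also have "\<dots> = (\<integral>u. (\<integral>v. \<rho> (v - u) * cosine_fn (i j) v * cosine_fn (i k) u \<partial>\<xi>) \<partial>\<xi>)"
          by (simp only: *)
        also have "\<dots> = (\<integral>(u, v). \<rho> (u - v) * cosine_fn (i j) u * cosine_fn (i k) v \<partial>(\<xi> \<Otimes>\<^sub>M \<xi>))"
          by (rule design_Fubini(1)[OF \<xi> \<xi> c, symmetric])
        finally show ?thesis .
      qed
      then show ?thesis by (simp add: B transpose_def vec_eq_iff)
    qed
    have symD: "transpose (D_matrix ?K ?f \<xi>) = D_matrix ?K ?f \<xi>"
      by (simp add: D_matrix_def matrix_transpose_mul symN symB matrix_mul_assoc)
    have quad: "x \<bullet> (D_matrix ?K ?f ?U *v x) \<le> x \<bullet> (D_matrix ?K ?f \<xi> *v x)" for x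
    proof -
      \<comment> \<open>This choice gives M(\<xi>) y = x, so the moments in
        \<open>cosine_energy_bound\<close> are the coordinates of the given vector.\<close>
      define y where "y = ?N *v x"
      define g where "g u = (\<Sum>k\<in>UNIV. y $ k * cosine_fn (i k) u)" for u
      have My: "?M *v y = x"
        by (simp add: y_def matrix_vector_mul_assoc matrix_inv_inverse[OF inv])
      have x: "x $ k = (\<Sum>j\<in>UNIV. y $ j * (\<integral>u. cosine_fn (i k) u * cosine_fn (i j) u \<partial>\<xi>))" for k
        unfolding My[symmetric] by (simp add: M matrix_vector_mult_def mult.commute)
      have "x \<bullet> (D_matrix ?K ?f ?U *v x) \<le> (\<integral>(u, v). \<rho> (u - v) * g u * g v \<partial>(\<xi> \<Otimes>\<^sub>M \<xi>))"
        using cosine_energy_bound[OF \<rho> per inj i \<xi>, of "\<lambda>k. y $ k"]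
        by (simp only: U_quad l_def g_def x)
      also have "\<dots> = (\<integral>p. (\<Sum>j\<in>UNIV. \<Sum>k\<in>UNIV. y $ j * y $ k *
          (case p of (u, v) \<Rightarrow> \<rho> (u - v) * cosine_fn (i j) u * cosine_fn (i k) v)) \<partial>(\<xi> \<Otimes>\<^sub>M \<xi>))"
        by (intro Bochner_Integration.integral_cong refl)
           (simp add: case_prod_unfold g_def sum_distrib_left sum_distrib_right mult_ac)
      also have "\<dots> = y \<bullet> (?B *v y)"
        unfolding inner_matrix_vector_sum
        by (simp add: Bochner_Integration.integral_sum integrable_pair_design_continuous[OF \<xi> \<xi> c] B)
      \<comment> \<open>The outer inverse in D(\<xi>) moves across the inner product, being
        symmetric.\<close>
      also have "\<dots> = x \<bullet> (D_matrix ?K ?f \<xi> *v x)"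
        by (simp add: D_matrix_def y_def inner_symmetric_matrix[OF symN] flip: matrix_vector_mul_assoc)
      finally show ?thesis .
    qed
    show ?thesis
      unfolding loewner_le_def positive_semidefinite_def
    proof (intro conjI allI)
      show "transpose (D_matrix ?K ?f \<xi> - D_matrix ?K ?f ?U) = D_matrix ?K ?f \<xi> - D_matrix ?K ?f ?U"
        using symD symU by (simp add: transpose_def vec_eq_iff)
      show "0 \<le> x \<bullet> ((D_matrix ?K ?f \<xi> - D_matrix ?K ?f ?U) *v x)" for x
        using quad[of x] by (simp add: matrix_vector_mult_diff_rdistrib inner_diff_right)
    qed
  qed
  ultimately show ?thesis
    by (simp add: universally_optimal_def)
qed

theorem theorem4p2:
  fixes \<rho> :: "real \<Rightarrow> real"
    and i :: "'m::{finite,linorder} \<Rightarrow> nat"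
  assumes "correlation_function \<rho>"
    and "\<forall>t. \<rho> t = \<rho> (t + 1)"
    and "strict_mono i"
    and "\<forall>k. 1 \<le> i k"
  shows "universally_optimal (\<lambda>u v. \<rho> (u - v)) (\<lambda>x. \<chi> k. cosine_fn (i k) x) uniform_design"
proof (rule universally_optimal_cosine)
  show "inj i"
    using assms(3) by (rule strict_mono_imp_inj_on)
qed (use assms in auto)

end
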